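(* Let $\Theta$ be a uniform substitution schema with $|\mathrm{dom}(\Theta)| = n$. Then there exist substitutions $\sigma_1,\dots,\sigma_n$ and a primitive substitution schema $\Xi$ such that (i) $\mathrm{dom}(\Xi)=\mathrm{dom}(\Theta)$, and (ii) for all $X\in\mathrm{dom}(\Xi)$, $\mathrm{base}_\Xi(X) = \mathrm{base}_\Theta(X)\sigma_1\cdots\sigma_n$ (the substitutions applied in sequence, postfix notation).
   Context: Let $\mathcal{V}_{sym}$ be a countably infinite set of variable symbols; the variables are the objects $X_i$ with $X\in\mathcal{V}_{sym}$ and $i\in\mathbb{N}$. Terms are first-order terms over a signature $\Sigma$ and these variables. For a variable $X_i$ put $\mathrm{cls}(X_i)=\{X\}$ and $\mathrm{idx}(X_i)=\{i\}$, extended to terms (and sets of terms) by taking unions over all variable occurrences. A substitution maps all but finitely many variables to themselves. For $d\ge 0$ the index shift $\mathrm{shift}_d$ is defined by $\mathrm{shift}_d(X_j)=X_{j+d}$ and $\mathrm{shift}_d(f(t_1,\dots,t_m))=f(\mathrm{shift}_d(t_1),\dots,\mathrm{shift}_d(t_m))$. A substitution schema is given by pairwise distinct symbols $X^1,\dots,X^n\in\mathcal{V}_{sym}$ and terms $t_1,\dots,t_n$; it is the (infinite) mapping $\Theta=\bigcup_{i=1}^n\{X^i_j\mapsto \mathrm{shift}_j(t_i)\mid j\ge 0\}$, with $\mathrm{dom}(\Theta)=\{X^1,\dots,X^n\}$ and $\mathrm{base}_\Theta(X^i)=t_i$. The base set of $\Theta$ is $\{\mathrm{base}_\Theta(X)\mid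 X\in\mathrm{dom}(\Theta)\}$. For $X\in\mathrm{dom}(\Theta)$, $R_\Theta(X)$ is the set of indices $i$ such that the variable $X_i$ occurs in $\mathrm{base}_\Theta(X)$. $\Theta$ is simple if every term $t$ of its base set satisfies $|\mathrm{cls}(t)\cap\mathrm{dom}(\Theta)|\le 1$; uniform if it is simple and $|R_\Theta(X)|\le 1$ for all $X\in\mathrm{dom}(\Theta)$; primitive if it is uniform and $R_\Theta(X)\subseteq\{0,1\}$ for all $X\in\mathrm{dom}(\Theta)$. *)

theory Defs
  imports Main "HOL-Library.Countable" "HOL-Library.Infinite_Typeclass"
begin

type_synonym 'v ivar = "'v \<times> nat"

datatype ('f, 'v) trm =
  Var "'v ivar"
| Fun 'f "('f, 'v) trm list"

text \<open>A signature assigns an arity to each of its function symbols; symbols mapped to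
  \<^term>\<open>None\<close> do not belong to it.\<close>

type_synonym 'f signature = "'f \<Rightarrow> nat option"

fun wf_trm :: "'f signature \<Rightarrow> ('f, 'v) trm \<Rightarrow> bool" where
  "wf_trm \<Sigma> (Var x) \<longleftrightarrow> True"
| "wf_trm \<Sigma> (Fun f ts) \<longleftrightarrow> \<Sigma> f = Some (length ts) \<and> (\<forall>t\<in>set ts. wf_trm \<Sigma> t)"

fun vars :: "('f, 'v) trm \<Rightarrow> 'v ivar set" where
  "vars (Var x) = {x}"
| "vars (Fun f ts) = (\<Union>t\<in>set ts. vars t)"

fun cls :: "('f, 'v) trm \<Rightarrow> 'v set" where
  "cls (Var (X, i)) = {X}"
| "cls (Fun f ts) = (\<Union>t\<in>set ts. cls t)"

fun shift :: "nat \<Rightarrow> ('f, 'v) trm \<Rightarrow> ('f, 'v) trm" where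
  "shift d (Var (X, j)) = Var (X, j + d)"
| "shift d (Fun f ts) = Fun f (map (shift d) ts)"

type_synonym ('f, 'v) subst = "'v ivar \<Rightarrow> ('f, 'v) trm"

definition is_subst :: "'f signature \<Rightarrow> ('f, 'v) subst \<Rightarrow> bool" where
  "is_subst \<Sigma> \<sigma> \<longleftrightarrow> finite {x. \<sigma> x \<noteq> Var x} \<and> (\<forall>x. wf_trm \<Sigma> (\<sigma> x))"

fun subst_apply :: "('f, 'v) trm \<Rightarrow> ('f, 'v) subst \<Rightarrow> ('f, 'v) trm" (infixl "\<cdot>" 67) where
  "Var x \<cdot> \<sigma> = \<sigma> x"
| "Fun f ts \<cdot> \<sigma> = Fun f (map (\<lambda>t. t \<cdot> \<sigma>) ts)"

text \<open>A schema is a partial map on variables, so that its domain is explicit even where the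
  map is the identity. It is given by a list of pairs of symbols \<open>X\<^sup>i\<close> and terms \<open>t\<^sub>i\<close>.\<close>

type_synonym ('f, 'v) schema = "'v ivar \<Rightarrow> ('f, 'v) trm option"

definition schema_generated_by :: "('f, 'v) schema \<Rightarrow> ('v \<times> ('f, 'v) trm) list \<Rightarrow> bool" where
  "schema_generated_by \<Theta> Xts \<longleftrightarrow>
     distinct (map fst Xts) \<and>
     Map.graph \<Theta> = (\<Union>(X, t)\<in>set Xts. {((X, j), shift j t) | j. j \<ge> 0})"

definition is_schema :: "'f signature \<Rightarrow> ('f, 'v) schema \<Rightarrow> bool" where
  "is_schema \<Sigma> \<Theta> \<longleftrightarrow>
     (\<exists>Xts. schema_generated_by \<Theta> Xts \<and> (\<forall>(X, t)\<in>set Xts. wf_trm \<Sigma> t))"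

definition sdom :: "('f, 'v) schema \<Rightarrow> 'v set" where
  "sdom \<Theta> = {X. \<exists>j. (X, j) \<in> dom \<Theta>}"

text \<open>Since \<open>shift 0 t = t\<close>, the term given for \<open>X\<close> is the image of the variable \<open>X\<^sub>0\<close>;
  see \<open>base_schema_generated_by\<close> below.\<close>

definition base :: "('f, 'v) schema \<Rightarrow> 'v \<Rightarrow> ('f, 'v) trm" where
  "base \<Theta> X = the (\<Theta> (X, 0))"

definition base_set :: "('f, 'v) schema \<Rightarrow> ('f, 'v) trm set" where
  "base_set \<Theta> = {base \<Theta> X | X. X \<in> sdom \<Theta>}"

definition rec_idx :: "('f, 'v) schema \<Rightarrow> 'v \<Rightarrow> nat set" where
  "rec_idx \<Theta> X = {i. (X, i) \<in> vars (base \<Theta> X)}"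

definition simple :: "('f, 'v) schema \<Rightarrow> bool" where
  "simple \<Theta> \<longleftrightarrow> (\<forall>t\<in>base_set \<Theta>. card (cls t \<inter> sdom \<Theta>) \<le> 1)"

definition uniform :: "('f, 'v) schema \<Rightarrow> bool" where
  "uniform \<Theta> \<longleftrightarrow> simple \<Theta> \<and> (\<forall>X\<in>sdom \<Theta>. card (rec_idx \<Theta> X) \<le> 1)"

definition primitive :: "('f, 'v) schema \<Rightarrow> bool" where
  "primitive \<Theta> \<longleftrightarrow> uniform \<Theta> \<and> (\<forall>X\<in>sdom \<Theta>. rec_idx \<Theta> X \<subseteq> {0, 1})"

lemma cls_conv_vars: "cls t = fst ` vars t"
  by (induction t rule: cls.induct) auto

lemma finite_vars: "finite (vars t)"
  by (induction t rule: vars.induct) auto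

lemma finite_cls: "finite (cls t)"
  by (simp add: cls_conv_vars finite_vars)

lemma finite_rec_idx: "finite (rec_idx \<Theta> X)"
proof (rule finite_subset)
  show "rec_idx \<Theta> X \<subseteq> snd ` vars (base \<Theta> X)"
    by (force simp: rec_idx_def)
qed (simp add: finite_vars)

lemma shift_0: "shift 0 t = t"
proof (induction t)
  case (Var x)
  then show ?case by (cases x) simp
qed (simp add: map_idI)

lemma schema_generated_by_Some_iff:
  assumes "schema_generated_by \<Theta> Xts"
  shows "\<Theta> (X, j) = Some s \<longleftrightarrow> (\<exists>t. (X, t) \<in> set Xts \<and> s = shift j t)"
proof -
  have "\<Theta> (X, j) = Some s \<longleftrightarrow> ((X, j), s) \<in> Map.graph \<Theta>"
    by (auto simp: Map.graph_def)
  then show ?thesis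
    using assms unfolding schema_generated_by_def by auto
qed

lemma sdom_schema_generated_by:
  assumes "schema_generated_by \<Theta> Xts"
  shows "sdom \<Theta> = fst ` set Xts"
  by (force simp: sdom_def dom_def schema_generated_by_Some_iff[OF assms])

lemma base_schema_generated_by:
  assumes "schema_generated_by \<Theta> Xts" and "(X, t) \<in> set Xts"
  shows "base \<Theta> X = t"
proof -
  have "\<Theta> (X, 0) = Some t"
    using assms(2) by (auto simp: schema_generated_by_Some_iff[OF assms(1)] shift_0)
  then show ?thesis by (simp add: base_def)
qed

lemma ex_schema_generated_by:
  assumes "distinct (map fst Xts)"
  shows "schema_generated_by (\<lambda>(X, j). map_option (shift j) (map_of Xts X)) Xts"
  using assms
  by (auto simp: schema_generated_by_def Map.graph_def map_of_eq_Some_iff)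

end

theory Submission imports Defs begin

text \<open>Truncating every variable index \<open>i\<close> of the base terms to \<open>min i 1\<close> changes no variable
  class, so simplicity is preserved, and it maps the recursion indices of each symbol onto their
  truncations, so there is still at most one of them and it lies in \<open>{0, 1}\<close>. Only finitely many
  variables occur in the base terms, so the truncation is a substitution. It is idempotent, so
  it may be applied \<open>n\<close> times whenever \<open>n > 0\<close>; for \<open>n = 0\<close> the domain is empty.\<close>

definition trunc_subst :: "'v ivar set \<Rightarrow> ('f, 'v) subst" where
  "trunc_subst V = (\<lambda>x. if x \<in> V then Var (fst x, min (snd x) 1) else Var x)"

lemma is_subst_trunc_subst:
  assumes "finite V"
  shows "is_subst \<Sigma> (trunc_subst V)"
proof -
  have "{x. trunc_subst V x \<noteq> (Var x :: ('b, 'a) trm)} \<subseteq> V"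
    by (auto simp: trunc_subst_def split: if_splits)
  then show ?thesis
    using assms finite_subset by (fastforce simp: is_subst_def trunc_subst_def)
qed

lemma wf_trm_subst_apply:
  assumes "is_subst \<Sigma> \<sigma>" and "wf_trm \<Sigma> t"
  shows "wf_trm \<Sigma> (t \<cdot> \<sigma>)"
  using assms(2) by (induction t) (use assms(1) in \<open>auto simp: is_subst_def\<close>)

lemma vars_subst_apply: "vars (t \<cdot> \<sigma>) = (\<Union>x\<in>vars t. vars (\<sigma> x))"
  by (induction t) auto

lemma cls_subst_trunc_subst:
  fixes t :: "('f, 'v) trm"
  shows "cls (t \<cdot> trunc_subst V) = cls t"
proof -
  have "fst ` vars (trunc_subst V x :: ('f, 'v) trm) = {fst x}" for x
    by (simp add: trunc_subst_def)
  then show ?thesis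
    by (simp add: UNION_singleton_eq_range cls_conv_vars vars_subst_apply image_UN)
qed

text \<open>\<open>V\<close> need not be closed under truncation: an index that is already at most 1
  is fixed whether or not its variable lies in \<open>V\<close>.\<close>

lemma trunc_subst_idem: "t \<cdot> trunc_subst V \<cdot> trunc_subst V = t \<cdot> trunc_subst V"
  by (induction t) (auto simp: trunc_subst_def)

text \<open>\<open>Suc n\<close> ensures at least one application; zero copies would leave
  \<open>t\<close> untruncated.\<close>

lemma foldl_replicate_trunc_subst:
  "foldl (\<cdot>) t (replicate (Suc n) (trunc_subst V)) = t \<cdot> trunc_subst V"
  by (induction n) (simp_all add: trunc_subst_idem)

theorem theorem1:
  fixes \<Sigma> :: "'f signature"
    and \<Theta> :: "('f, 'v :: {countable, infinite}) schema"
    and n :: nat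
  assumes "is_schema \<Sigma> \<Theta>"
    and "uniform \<Theta>"
    and "card (sdom \<Theta>) = n"
  shows "\<exists>(\<sigma>s :: ('f, 'v) subst list) (\<Xi> :: ('f, 'v) schema).
           length \<sigma>s = n \<and> (\<forall>\<sigma>\<in>set \<sigma>s. is_subst \<Sigma> \<sigma>) \<and>
           is_schema \<Sigma> \<Xi> \<and> primitive \<Xi> \<and>
           sdom \<Xi> = sdom \<Theta> \<and>
           (\<forall>X\<in>sdom \<Xi>. base \<Xi> X = foldl (\<cdot>) (base \<Theta> X) \<sigma>s)"
proof -
  obtain Xts where gen: "schema_generated_by \<Theta> Xts" and wf: "\<forall>(X, t)\<in>set Xts. wf_trm \<Sigma> t"
    using assms(1) by (auto simp: is_schema_def)
  define V where "V = (\<Union>(X, t)\<in>set Xts. vars t)"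
  define \<sigma> :: "('f, 'v) subst" where "\<sigma> = trunc_subst V"
  define Yts where "Yts = map (\<lambda>(X, t). (X, t \<cdot> \<sigma>)) Xts"
  \<comment> \<open>Truncation does not commute with \<open>shift\<close>, so
    \<open>\<sigma>\<close> acts on the base terms only and the schema is regenerated from
    them.\<close>
  define \<Xi> :: "('f, 'v) schema" where "\<Xi> = (\<lambda>(X, j). map_option (shift j) (map_of Yts X))"
  have subst: "is_subst \<Sigma> \<sigma>"
    unfolding \<sigma>_def V_def by (rule is_subst_trunc_subst) (auto simp: finite_vars)
  have fst_Yts: "map fst Yts = map fst Xts"
    by (auto simp: Yts_def)
  then have gen': "schema_generated_by \<Xi> Yts"
    unfolding \<Xi>_def using gen by (intro ex_schema_generated_by) (simp add: schema_generated_by_def)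
  have schema: "is_schema \<Sigma> \<Xi>"
    unfolding is_schema_def
    using gen' wf wf_trm_subst_apply[OF subst] by (force simp: Yts_def)
  have sdom: "sdom \<Xi> = sdom \<Theta>"
    using fst_Yts by (metis gen gen' sdom_schema_generated_by set_map)
  have base: "base \<Xi> X = base \<Theta> X \<cdot> \<sigma>" and V: "vars (base \<Theta> X) \<subseteq> V" if X: "X \<in> sdom \<Theta>" for X
  proof -
    obtain t where t: "(X, t) \<in> set Xts"
      using X by (auto simp: sdom_schema_generated_by[OF gen])
    then have "(X, t \<cdot> \<sigma>) \<in> set Yts"
      by (force simp: Yts_def)
    with t show "base \<Xi> X = base \<Theta> X \<cdot> \<sigma>" "vars (base \<Theta> X) \<subseteq> V"
      by (auto simp: base_schema_generated_by[OF gen] base_schema_generated_by[OF gen'] V_def)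
  qed
  \<comment> \<open>Since \<open>V\<close> contains every variable of the base term, each occurrence
    of \<open>(X, i)\<close> in the new one stems from some \<open>(X, k)\<close> with
    \<open>i = min k 1\<close>.\<close>
  have rec_idx: "rec_idx \<Xi> X \<subseteq> (\<lambda>i. min i 1) ` rec_idx \<Theta> X" if X: "X \<in> sdom \<Theta>" for X
    using V[OF X]
    by (force simp: rec_idx_def base[OF X] vars_subst_apply \<sigma>_def trunc_subst_def split: if_splits)
  \<comment> \<open>Neither the classes of the base terms nor the domain have changed.\<close>
  have "simple \<Xi>"
    using assms(2)
    by (auto simp: uniform_def simple_def base_set_def sdom base \<sigma>_def cls_subst_trunc_subst)
  moreover have "card (rec_idx \<Xi> X) \<le> 1" if X: "X \<in> sdom \<Theta>" for X
  proof -
    have "card (rec_idx \<Xi> X) \<le> card (rec_idx \<Theta> X)"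
      using rec_idx[OF X] by (rule surj_card_le[OF finite_rec_idx])
    then show ?thesis
      using assms(2) X by (force simp: uniform_def)
  qed
  moreover have "rec_idx \<Xi> X \<subseteq> {0, 1}" if "X \<in> sdom \<Theta>" for X
    using rec_idx[OF that] by (auto simp: min_def)
  ultimately have prim: "primitive \<Xi>"
    by (simp add: primitive_def uniform_def sdom)
  have "base \<Xi> X = foldl (\<cdot>) (base \<Theta> X) (replicate n \<sigma>)" if X: "X \<in> sdom \<Theta>" for X
  proof -
    \<comment> \<open>An infinite set also has \<open>card\<close> 0, so finiteness is needed to
      infer \<open>n \<noteq> 0\<close> from the member \<open>X\<close>.\<close>
    have "finite (sdom \<Theta>)"
      by (simp add: sdom_schema_generated_by[OF gen])
    then have "n \<noteq> 0"
      using assms(3) X card_0_eq by blast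
    then obtain m where "n = Suc m"
      by (cases n) auto
    then show ?thesis
      using base[OF X] by (simp only: \<sigma>_def foldl_replicate_trunc_subst)
  qed
  then show ?thesis
    using subst schema prim sdom by (intro exI[of _ "replicate n \<sigma>"] exI[of _ \<Xi>]) auto
qed

end
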